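(* Let $x^0\in\mathbb{R}^n$ be arbitrary, let $\underline f=\inf_{x\in\mathbb{R}^n}f(x)$, and assume that $\epsilon$ satisfies $$0<\epsilon<n\lambda\left[\frac{\sqrt{2L_f[F(x^0)+\epsilon-\underline f]}}{\lambda p}\right]^q .$$ Let $\{x^k\}$ be a sequence generated from $x^0$ with this $\epsilon$ by the variant of the new $\mathrm{IRL}_1$ minimization method (described in the context). Suppose that $x^*$ is an accumulation point of $\{x^k\}$. Then $x^*$ is a first-order stationary point of $\min_{x\in\mathbb{R}^n}\{F(x)=f(x)+\lambda\|x\|_p^p\}$, i.e., $x^*_i\,\partial f(x^* )/\partial x_i+\lambda p|x^*_i|^p=0$ for all $i$. Moreover, the nonzero entries of $x^*$ satisfy $$|x^*_i|\ge\left(\frac{\lambda p}{\sqrt{2L_f[F(x^0)+\epsilon-\underline f]}}\right)^{\frac1{1-p}}\quad\text{for all } i \text{ with } x^*_i\ne0.$$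
   Context: Here $\lambda>0$, $p\in(0,1)$, and $q$ is defined by $\frac1p+\frac1q=1$ (so $q<0$). Convention: $0^\beta=\infty$ for $\beta<0$. The function $f:\mathbb{R}^n\to\mathbb{R}$ is continuously differentiable, bounded below, with $L_f$-Lipschitz continuous gradient, $L_f>0$: $\|\nabla f(x)-\nabla f(y)\|_2\le L_f\|x-y\|_2$ for all $x,y$. $\|x\|_p^p=\sum_i|x_i|^p$. With $u_\epsilon=(\frac{\epsilon}{\lambda n})^{1/q}$ let $h_{u_\epsilon}(t)=\min_{0\le s\le u_\epsilon}p(|t|s-\frac{s^q}{q})$ for $t\in\mathbb{R}$ and $F_\epsilon(x)=f(x)+\lambda\sum_{i=1}^nh_{u_\epsilon}(x_i)$. The variant of the new $\mathrm{IRL}_1$ method: let $0<L_{\min}<L_{\max}$, $\tau>1$, $c>0$ be given. For $k=0,1,2,\dots$: choose $L^0_k\in[L_{\min},L_{\max}]$ arbitrarily and set $L_k=L^0_k$; then (1a) compute $$x^{k+1}\in\mathrm{Arg\,min}_x\left\{f(x^k)+\nabla f(x^k)^T(x-x^k)+\frac{L_k}{2}\|x-x^k\|_2^2+\lambda p\sum_{i=1}^n s^k_i|x_i|\right\},\quad s^k_i=\min\left\{\left(\tfrac{\epsilon}{\lambda n}\right)^{\frac1q},|x^k_i|^{\frac1{q-1}}\right\};$$ (1b) if $F_\epsilon(x^k)-F_\epsilon(x^{k+1})\ge\frac c2\|x^{k+1}-x^k\|_2^2$, accept $x^{k+1}$ and go to the next $k$; (1c) otherwise set $L_k\leftarrow\tau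 L_k$ and return to (1a). *)

theory Defs
  imports "HOL-Analysis.Analysis"
begin

text \<open>Powers of nonnegative reals with the convention \<open>0\<^sup>b = \<infinity>\<close> for \<open>b < 0\<close>
  (whereas \<open>0 powr b = 0\<close>).\<close>

definition epowr :: "real \<Rightarrow> real \<Rightarrow> ereal" where
  "epowr x b = (if x = 0 \<and> b < 0 then \<infinity> else ereal (x powr b))"

definition hobj :: "real \<Rightarrow> real \<Rightarrow> real \<Rightarrow> real \<Rightarrow> ereal" where
  "hobj p q t s = ereal p * (ereal (\<bar>t\<bar> * s) - epowr s q / ereal q)"

text \<open>The infimum below is finite and attained, by \<open>hfun_is_min\<close>.\<close>

definition hfun :: "real \<Rightarrow> real \<Rightarrow> real \<Rightarrow> real \<Rightarrow> real" where
  "hfun p q u t = real_of_ereal (INF s\<in>{0..u}. hobj p q t s)"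

lemma hobj_pos:
  assumes "0 < s" "q \<noteq> 0"
  shows "hobj p q t s = ereal (p * (\<bar>t\<bar> * s - s powr q / q))"
  using assms by (simp add: hobj_def epowr_def)

lemma hobj_zero:
  assumes "0 < p" "q < 0"
  shows "hobj p q t 0 = \<infinity>"
  using assms by (simp add: hobj_def epowr_def divide_ereal_def)

lemma hfun_is_min:
  assumes p: "0 < p" and q: "q < 0" and u: "0 < u"
  shows "\<exists>s\<in>{0..u}. hobj p q t s = ereal (hfun p q u t)"
    and "\<forall>s\<in>{0..u}. ereal (hfun p q u t) \<le> hobj p q t s"
proof -
  define g where "g s = p * (\<bar>t\<bar> * s - s powr q / q)" for s
  define v where "v = \<bar>t\<bar> * u - u powr q / q"
  have vpos: "0 < v"
  proof -
    have "u powr q / q < 0" using u q by (simp add: divide_pos_neg)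
    moreover have "0 \<le> \<bar>t\<bar> * u" using u by simp
    ultimately show ?thesis unfolding v_def by linarith
  qed
  define a where "a = min u ((- q * v) powr (1 / q))"
  have apos: "0 < a" using u q vpos by (simp add: a_def)
  have au: "a \<le> u" by (simp add: a_def)
  have small: "g u \<le> g s" if "0 < s" "s \<le> a" for s
  proof -
    have "s \<le> (- q * v) powr (1 / q)" using that by (simp add: a_def)
    hence "((- q * v) powr (1 / q)) powr q \<le> s powr q"
      using that q by (intro powr_mono2') auto
    hence "- q * v \<le> s powr q" using q vpos by (simp add: powr_powr mult_neg_pos)
    hence "v \<le> - (s powr q / q)" using q by (simp add: field_simps)
    also have "\<dots> \<le> \<bar>t\<bar> * s - s powr q / q" using that by simp
    finally show ?thesis using p by (simp add: g_def v_def)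
  qed
  have "continuous_on {a..u} g"
    unfolding g_def using apos q by (intro continuous_intros) auto
  then obtain m where m: "m \<in> {a..u}" "\<And>s. s \<in> {a..u} \<Longrightarrow> g m \<le> g s"
    using continuous_attains_inf[of "{a..u}" g] au by auto
  have m0: "m \<in> {0..u}" "0 < m" using m apos by auto
  have gm: "hobj p q t m = ereal (g m)" using m0 q by (simp add: hobj_pos g_def)
  have le: "ereal (g m) \<le> hobj p q t s" if s: "s \<in> {0..u}" for s
  proof (cases "s = 0")
    case True
    then show ?thesis using p q by (simp add: hobj_zero)
  next
    case False
    hence "g m \<le> g s"
      using s m(2)[of s] m(2)[of u] small[of s] au by (cases "s \<le> a") auto
    then show ?thesis using False s q by (simp add: hobj_pos g_def)
  qed
  have "(INF s\<in>{0..u}. hobj p q t s) = ereal (g m)"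
    using le m0 gm by (intro antisym INF_greatest) (auto intro: INF_lower2[of m])
  hence h: "hfun p q u t = g m" by (simp add: hfun_def)
  show "\<exists>s\<in>{0..u}. hobj p q t s = ereal (hfun p q u t)"
    using gm m0 h by auto
  show "\<forall>s\<in>{0..u}. ereal (hfun p q u t) \<le> hobj p q t s"
    using le h by simp
qed

definition lp_objective :: "(real ^ 'n \<Rightarrow> real) \<Rightarrow> real \<Rightarrow> real \<Rightarrow> real ^ 'n \<Rightarrow> real" where
  "lp_objective f lam p x = f x + lam * (\<Sum>i\<in>UNIV. \<bar>x $ i\<bar> powr p)"

definition ueps :: "real \<Rightarrow> real \<Rightarrow> nat \<Rightarrow> real \<Rightarrow> real" where
  "ueps lam q n eps = (eps / (lam * real n)) powr (1 / q)"

definition F_eps ::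
  "(real ^ 'n \<Rightarrow> real) \<Rightarrow> real \<Rightarrow> real \<Rightarrow> real \<Rightarrow> real \<Rightarrow> real ^ 'n \<Rightarrow> real" where
  "F_eps f lam p q eps x =
     f x + lam * (\<Sum>i\<in>UNIV. hfun p q (ueps lam q CARD('n) eps) (x $ i))"

definition irl1_weight :: "real \<Rightarrow> real \<Rightarrow> real \<Rightarrow> real ^ 'n \<Rightarrow> 'n \<Rightarrow> real" where
  "irl1_weight lam q eps x i =
     real_of_ereal (min (ereal (ueps lam q CARD('n) eps)) (epowr \<bar>x $ i\<bar> (1 / (q - 1))))"

text \<open>From here on, \<open>g\<close> stands for the gradient of \<open>f\<close>, and \<open>L\<close> for the current trial constant.\<close>

definition irl1_model ::
  "(real ^ 'n \<Rightarrow> real) \<Rightarrow> (real ^ 'n \<Rightarrow> real ^ 'n) \<Rightarrow>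
     real \<Rightarrow> real \<Rightarrow> real \<Rightarrow> real \<Rightarrow> real ^ 'n \<Rightarrow> real \<Rightarrow> real ^ 'n \<Rightarrow> real" where
  "irl1_model f g lam p q eps x L y =
     f x + g x \<bullet> (y - x) + L / 2 * (norm (y - x))\<^sup>2
       + lam * p * (\<Sum>i\<in>UNIV. irl1_weight lam q eps x i * \<bar>y $ i\<bar>)"

definition irl1_sufficient_decrease ::
  "(real ^ 'n \<Rightarrow> real) \<Rightarrow> real \<Rightarrow> real \<Rightarrow> real \<Rightarrow> real \<Rightarrow> real \<Rightarrow>
     real ^ 'n \<Rightarrow> real ^ 'n \<Rightarrow> bool" where
  "irl1_sufficient_decrease f lam p q eps c x y \<longleftrightarrow>
     F_eps f lam p q eps x - F_eps f lam p q eps y \<ge> c / 2 * (norm (y - x))\<^sup>2"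

text \<open>\<open>irl1_step \<dots> x L z\<close>: the backtracking loop, entered with trial constant \<open>L\<close>,
  terminates and can accept \<open>z\<close> as the next iterate.\<close>

inductive irl1_step ::
  "(real ^ 'n \<Rightarrow> real) \<Rightarrow> (real ^ 'n \<Rightarrow> real ^ 'n) \<Rightarrow>
     real \<Rightarrow> real \<Rightarrow> real \<Rightarrow> real \<Rightarrow> real \<Rightarrow> real \<Rightarrow>
     real ^ 'n \<Rightarrow> real \<Rightarrow> real ^ 'n \<Rightarrow> bool"
  for f g lam p q eps \<tau> c x where
  accept:
    "is_arg_min (irl1_model f g lam p q eps x L) (\<lambda>_. True) y \<Longrightarrow>
     irl1_sufficient_decrease f lam p q eps c x y \<Longrightarrow>
     irl1_step f g lam p q eps \<tau> c x L y"
| backtrack: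
    "is_arg_min (irl1_model f g lam p q eps x L) (\<lambda>_. True) y \<Longrightarrow>
     \<not> irl1_sufficient_decrease f lam p q eps c x y \<Longrightarrow>
     irl1_step f g lam p q eps \<tau> c x (\<tau> * L) z \<Longrightarrow>
     irl1_step f g lam p q eps \<tau> c x L z"

definition irl1_sequence ::
  "(real ^ 'n \<Rightarrow> real) \<Rightarrow> (real ^ 'n \<Rightarrow> real ^ 'n) \<Rightarrow>
     real \<Rightarrow> real \<Rightarrow> real \<Rightarrow> real \<Rightarrow> real \<Rightarrow> real \<Rightarrow> real \<Rightarrow> real \<Rightarrow>
     real ^ 'n \<Rightarrow> (nat \<Rightarrow> real ^ 'n) \<Rightarrow> bool" where
  "irl1_sequence f g lam p q eps Lmin Lmax \<tau> c x0 x \<longleftrightarrow>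
     x 0 = x0 \<and>
     (\<forall>k. \<exists>L0\<in>{Lmin..Lmax}. irl1_step f g lam p q eps \<tau> c (x k) L0 (x (Suc k)))"

definition accumulation_point :: "(nat \<Rightarrow> 'a::topological_space) \<Rightarrow> 'a \<Rightarrow> bool" where
  "accumulation_point x l \<longleftrightarrow> (\<exists>r. strict_mono r \<and> (x \<circ> r) \<longlonglongrightarrow> l)"

definition first_order_stationary ::
  "(real ^ 'n \<Rightarrow> real ^ 'n) \<Rightarrow> real \<Rightarrow> real \<Rightarrow> real ^ 'n \<Rightarrow> bool" where
  "first_order_stationary g lam p x \<longleftrightarrow>
     (\<forall>i. x $ i * g x $ i + lam * p * \<bar>x $ i\<bar> powr p = 0)"

end

theory Submission
  imports Defs
begin

text \<open>The weights minimise the variational formula for \<open>hfun\<close>, so the weighted model with constant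
  \<open>L\<close> majorises \<open>F_eps\<close> once \<open>L \<ge> Lf\<close>; hence backtracking stops at a bounded \<open>L\<close>, and the sufficient
  decrease forces consecutive iterates together. Multiplying the optimality condition of the model
  by the coordinate gives an equation that passes to the limit, with the weight
  \<open>min u (\<bar>xstar $ i\<bar> powr (p - 1))\<close>. Since \<open>F_eps\<close> decreases along the sequence, the descent lemma
  bounds the gradient by the square root in the theorem, which is smaller than \<open>lam * p * u\<close> by the
  choice of \<open>eps\<close>. So the minimum is not \<open>u\<close>, which yields both stationarity and the lower bound.\<close>

section \<open>Functions with Lipschitz gradient\<close>

text \<open>The gap \<open>\<phi>\<close> between \<open>f\<close> and the quadratic bound along the
  segment has derivative at most 0 on [0,1], by Cauchy-Schwarz and the Lipschitz bound.\<close>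

lemma descent_lemma:
  fixes f :: "'a::real_inner \<Rightarrow> real"
  assumes grad: "\<And>y. GDERIV f y :> g y"
    and lip: "\<And>y z. norm (g y - g z) \<le> L * norm (y - z)"
  shows "f y \<le> f x + g x \<bullet> (y - x) + L / 2 * (norm (y - x))\<^sup>2"
proof -
  define d where "d = y - x"
  define \<phi> where "\<phi> t = f (x + t *\<^sub>R d) - t * (g x \<bullet> d) - L / 2 * t\<^sup>2 * (norm d)\<^sup>2" for t
  have der: "(\<phi> has_real_derivative (g (x + t *\<^sub>R d) - g x) \<bullet> d - L * t * (norm d)\<^sup>2) (at t)" for t
  proof -
    have "((\<lambda>t. f (x + t *\<^sub>R d)) has_derivative (\<lambda>h. (h *\<^sub>R d) \<bullet> g (x + t *\<^sub>R d))) (at t)"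
      by (rule has_derivative_compose[where f = "\<lambda>t. x + t *\<^sub>R d" and g = f])
        (use grad in \<open>auto simp: gderiv_def intro!: derivative_eq_intros\<close>)
    hence "((\<lambda>t. f (x + t *\<^sub>R d)) has_real_derivative g (x + t *\<^sub>R d) \<bullet> d) (at t)"
      by (simp add: has_field_derivative_def inner_commute mult_commute_abs)
    thus ?thesis unfolding \<phi>_def
      by (auto intro!: derivative_eq_intros simp: algebra_simps inner_diff_left)
  qed
  have "\<phi> 1 \<le> \<phi> 0"
  proof (rule DERIV_nonpos_imp_nonincreasing[where f = \<phi>])
    fix t :: real assume t: "0 \<le> t" "t \<le> 1"
    have "(g (x + t *\<^sub>R d) - g x) \<bullet> d \<le> norm (g (x + t *\<^sub>R d) - g x) * norm d"
      by (rule norm_cauchy_schwarz)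
    also have "\<dots> \<le> L * norm (t *\<^sub>R d) * norm d"
      using lip[of "x + t *\<^sub>R d" x] by (simp add: mult_right_mono)
    also have "\<dots> = L * t * (norm d)\<^sup>2" using t by (simp add: power2_eq_square)
    finally show "\<exists>y. (\<phi> has_real_derivative y) (at t) \<and> y \<le> 0"
      using der by (intro exI[of _ "(g (x + t *\<^sub>R d) - g x) \<bullet> d - L * t * (norm d)\<^sup>2"]) auto
  qed simp
  thus ?thesis by (simp add: \<phi>_def d_def)
qed

text \<open>A gradient step of length \<open>1 / L\<close> lowers \<open>f\<close> by at least the
  squared gradient norm over \<open>2 * L\<close>, yet cannot go below the infimum.\<close>

lemma norm_gradient_le:
  fixes f :: "'a::real_inner \<Rightarrow> real"
  assumes grad: "\<And>y. GDERIV f y :> g y"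
    and lip: "\<And>y z. norm (g y - g z) \<le> L * norm (y - z)"
    and L: "0 < L" and bdd: "bdd_below (range f)"
  shows "norm (g x) \<le> sqrt (2 * L * (f x - (INF y. f y)))"
proof -
  let ?y = "x - (1 / L) *\<^sub>R g x"
  have "(INF y. f y) \<le> f ?y" using bdd by (simp add: cINF_lower)
  also have "\<dots> \<le> f x + g x \<bullet> (?y - x) + L / 2 * (norm (?y - x))\<^sup>2"
    by (rule descent_lemma[OF grad lip])
  also have "\<dots> = f x - (norm (g x))\<^sup>2 / (2 * L)"
    using L by (simp add: power2_norm_eq_inner[symmetric] power_divide field_simps power2_eq_square)
  finally have "(norm (g x))\<^sup>2 \<le> 2 * L * (f x - (INF y. f y))"
    using L by (simp add: field_simps)
  thus ?thesis by (rule real_le_rsqrt)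
qed

section \<open>The one-dimensional penalty and its minimiser\<close>

text \<open>Convexity of the power: \<open>ln z \<le> z - 1\<close>, reversed by the factor
  \<open>q < 0\<close>, followed by \<open>1 + z \<le> exp z\<close>.\<close>

lemma powr_tangent_le:
  fixes s S q :: real
  assumes "0 < s" "0 < S" "q < 0"
  shows "S powr q + q * S powr (q - 1) * (s - S) \<le> s powr q"
proof -
  have "q * (s / S - 1) \<le> q * ln (s / S)"
    using assms ln_le_minus_one[of "s / S"] by (intro mult_left_mono_neg) auto
  also have "\<dots> + 1 \<le> exp (q * ln (s / S))" by (simp add: add.commute)
  also have "\<dots> = (s / S) powr q" using assms by (simp add: powr_def)
  finally have "S powr q * (1 + q * (s / S - 1)) \<le> S powr q * (s / S) powr q"
    by (intro mult_left_mono) auto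
  thus ?thesis using assms by (simp add: powr_divide powr_diff field_simps)
qed

lemma conjugate_exponent:
  fixes p q :: real
  assumes "0 < p" "p < 1" "1 / p + 1 / q = 1"
  shows "q < 0" "q = p / (p - 1)" "1 / (q - 1) = p - 1" "(1 - p) * q = - p" "p / q = p - 1"
proof -
  have "q \<noteq> 0" using assms by auto
  hence *: "q * (p - 1) = p" using assms by (simp add: field_simps)
  show "q = p / (p - 1)" using * assms by (simp add: field_simps)
  thus "q < 0" using assms by (simp add: divide_pos_neg)
  show "(1 - p) * q = - p" using * by (simp add: algebra_simps)
  have "(q - 1) * (p - 1) = 1" using * by (simp add: algebra_simps)
  thus "1 / (q - 1) = p - 1" using assms by (metis divide_eq_eq mult.commute mult_zero_left zero_neq_one)
  show "p / q = p - 1" using * \<open>q \<noteq> 0\<close> by (simp add: field_simps)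
qed

text \<open>The case split carries the convention that 0 to a negative power is infinite into the
  reals, where \<open>0 powr b = 0\<close> would give weight 0.\<close>

lemma irl1_weight_eq:
  fixes x :: "real ^ 'n"
  assumes "q < 0"
  shows "irl1_weight lam q eps x i =
    (if x $ i = 0 then ueps lam q CARD('n) eps
     else min (ueps lam q CARD('n) eps) (\<bar>x $ i\<bar> powr (1 / (q - 1))))"
proof -
  have "1 / (q - 1) < 0" using assms by simp
  thus ?thesis
    unfolding irl1_weight_def epowr_def by (auto simp: min_def)
qed

lemma hfun_le:
  assumes "0 < p" "q < 0" "0 < s" "s \<le> u"
  shows "hfun p q u t \<le> p * (\<bar>t\<bar> * s - s powr q / q)"
proof -
  have "0 < u" using assms by linarith
  hence "ereal (hfun p q u t) \<le> hobj p q t s"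
    using hfun_is_min(2)[OF assms(1,2), of u t] assms by auto
  thus ?thesis using assms by (simp add: hobj_pos)
qed

lemma hfun_attained:
  assumes "0 < p" "q < 0" "0 < u"
  obtains s where "0 < s" "s \<le> u" "hfun p q u t = p * (\<bar>t\<bar> * s - s powr q / q)"
proof -
  obtain s where s: "s \<in> {0..u}" "hobj p q t s = ereal (hfun p q u t)"
    using hfun_is_min(1)[OF assms] by blast
  have "s \<noteq> 0" using s hobj_zero[OF assms(1,2), of t] by auto
  with s that[of s] assms show ?thesis by (auto simp: hobj_pos)
qed

lemma hfun_nonneg:
  assumes "0 < p" "q < 0" "0 < u"
  shows "0 \<le> hfun p q u t"
proof -
  obtain s where s: "0 < s" "hfun p q u t = p * (\<bar>t\<bar> * s - s powr q / q)"
    using hfun_attained[OF assms] by metis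
  moreover have "s powr q / q \<le> 0" "0 \<le> \<bar>t\<bar> * s"
    using s assms by (auto simp: divide_nonneg_neg)
  hence "0 \<le> \<bar>t\<bar> * s - s powr q / q" by linarith
  ultimately show ?thesis using assms by simp
qed

text \<open>\<open>S\<close> is the weight formula of the method, since
  \<open>1 / (q - 1) = p - 1\<close>. The objective is convex in \<open>s\<close>, so the tangent
  bound at \<open>S\<close> reduces minimality to the first-order condition on
  \<open>{0<..u}\<close>.\<close>

lemma hfun_eq:
  fixes t :: real
  assumes p: "0 < p" "p < 1" "1 / p + 1 / q = 1" and u: "0 < u"
  defines "S \<equiv> (if t = 0 then u else min u (\<bar>t\<bar> powr (p - 1)))"
  shows "hfun p q u t = p * (\<bar>t\<bar> * S - S powr q / q)"
proof -
  note q = conjugate_exponent[OF p]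
  have S: "0 < S" "S \<le> u" using u by (auto simp: S_def)
  have pw: "(\<bar>t\<bar> powr (p - 1)) powr (q - 1) = \<bar>t\<bar>" if "t \<noteq> 0"
  proof -
    have "(p - 1) * (q - 1) = 1" using q(4) by (simp add: algebra_simps)
    thus ?thesis using that by (simp add: powr_powr)
  qed
  obtain s where s: "0 < s" "s \<le> u" "hfun p q u t = p * (\<bar>t\<bar> * s - s powr q / q)"
    using hfun_attained[OF p(1) q(1) u] by metis
  \<comment> \<open>The second factor is the derivative at \<open>S\<close> up to the factor
    \<open>p\<close>. It vanishes when \<open>S\<close> is the stationary point; otherwise
    \<open>S = u\<close>, and both factors are nonpositive.\<close>
  have "0 \<le> (s - S) * (\<bar>t\<bar> - S powr (q - 1))"
  proof (cases "t \<noteq> 0 \<and> \<bar>t\<bar> powr (p - 1) \<le> u")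
    case True
    hence "S = \<bar>t\<bar> powr (p - 1)" by (simp add: S_def)
    thus ?thesis using True pw by simp
  next
    case False
    hence Su: "S = u" by (auto simp: S_def)
    have "\<bar>t\<bar> \<le> u powr (q - 1)"
    proof (cases "t = 0")
      case nz: False
      hence "(\<bar>t\<bar> powr (p - 1)) powr (q - 1) \<le> u powr (q - 1)"
        using False u q(1) by (intro powr_mono2') auto
      thus ?thesis using pw nz by simp
    qed simp
    thus ?thesis using s Su by (simp add: mult_nonpos_nonpos)
  qed
  moreover have "S powr q + q * S powr (q - 1) * (s - S) \<le> s powr q"
    using powr_tangent_le s S q by blast
  hence "s powr q / q \<le> S powr q / q + S powr (q - 1) * (s - S)"
    using q(1) by (simp add: field_simps)
  ultimately have "\<bar>t\<bar> * S - S powr q / q \<le> \<bar>t\<bar> * s - s powr q / q"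
    by (simp add: algebra_simps)
  hence "p * (\<bar>t\<bar> * S - S powr q / q) \<le> hfun p q u t" using s p by simp
  moreover have "hfun p q u t \<le> p * (\<bar>t\<bar> * S - S powr q / q)"
    using hfun_le p q S by blast
  ultimately show ?thesis by simp
qed

text \<open>The stationary point, if admissible, gives exactly \<open>\<bar>t\<bar> powr p\<close>.
  Otherwise \<open>s = u\<close> is inserted: its linear term stays below
  \<open>\<bar>t\<bar> powr p\<close> and the rest below \<open>u powr q\<close>.\<close>

lemma hfun_le_powr_add:
  assumes p: "0 < p" "p < 1" "1 / p + 1 / q = 1" and u: "0 < u"
  shows "hfun p q u t \<le> \<bar>t\<bar> powr p + u powr q"
proof -
  note q = conjugate_exponent[OF p]
  have expand: "p * (a - b / q) = p * a + (1 - p) * b" for a b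
  proof -
    have "p * (a - b / q) = p * a - p / q * b" by (simp add: algebra_simps)
    thus ?thesis using q(5) by (simp add: algebra_simps)
  qed
  show ?thesis
  proof (cases "t \<noteq> 0 \<and> \<bar>t\<bar> powr (p - 1) \<le> u")
    case True
    hence "(\<bar>t\<bar> powr (p - 1)) powr q = \<bar>t\<bar> powr p" "\<bar>t\<bar> * \<bar>t\<bar> powr (p - 1) = \<bar>t\<bar> powr p"
      using q p by (auto simp: powr_powr powr_mult_base)
    hence "p * (\<bar>t\<bar> * \<bar>t\<bar> powr (p - 1) - (\<bar>t\<bar> powr (p - 1)) powr q / q) = \<bar>t\<bar> powr p"
      unfolding expand by (simp add: algebra_simps)
    thus ?thesis using True hfun_le[OF p(1) q(1), of "\<bar>t\<bar> powr (p - 1)" u t]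
      by (simp add: add_increasing2)
  next
    case False
    have "\<bar>t\<bar> * u \<le> \<bar>t\<bar> powr p"
    proof (cases "t = 0")
      case nz: False
      hence "\<bar>t\<bar> * u \<le> \<bar>t\<bar> * \<bar>t\<bar> powr (p - 1)"
        using False by (intro mult_left_mono) auto
      thus ?thesis using nz by (simp add: powr_mult_base)
    qed simp
    moreover have "p * (\<bar>t\<bar> * u) \<le> 1 * (\<bar>t\<bar> * u)" "(1 - p) * u powr q \<le> 1 * u powr q"
      using p u by (intro mult_right_mono; simp)+
    moreover have "hfun p q u t \<le> p * (\<bar>t\<bar> * u) + (1 - p) * u powr q"
      using hfun_le[OF p(1) q(1) u, of u t] unfolding expand by simp
    ultimately show ?thesis by linarith
  qed
qed

section \<open>The smoothed objective\<close>

lemma irl1_weight_bounds: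
  fixes x :: "real ^ 'n"
  assumes "q < 0" "0 < lam" "0 < eps"
  shows "0 < irl1_weight lam q eps x i" "irl1_weight lam q eps x i \<le> ueps lam q CARD('n) eps"
  using assms by (auto simp: irl1_weight_eq ueps_def)

text \<open>Freezing \<open>s\<close> at the weights of \<open>x\<close> gives a majorant in
  \<open>y\<close>, because these weights are admissible for every coordinate of
  \<open>y\<close>.\<close>

lemma F_eps_le:
  fixes x y :: "real ^ 'n"
  assumes p: "0 < p" "p < 1" "1 / p + 1 / q = 1" and "0 < lam" "0 < eps"
  defines "w \<equiv> irl1_weight lam q eps x"
  shows "F_eps f lam p q eps y \<le> f y + lam * (\<Sum>i\<in>UNIV. p * (\<bar>y $ i\<bar> * w i - w i powr q / q))"
  unfolding F_eps_def w_def using assms conjugate_exponent(1)[OF p]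
  by (intro add_left_mono mult_left_mono sum_mono hfun_le irl1_weight_bounds) auto

text \<open>The majorant touches at \<open>y = x\<close>, where the weights are the minimisers from
  \<open>hfun_eq\<close>.\<close>

lemma F_eps_eq:
  fixes x :: "real ^ 'n"
  assumes p: "0 < p" "p < 1" "1 / p + 1 / q = 1" and "0 < lam" "0 < eps"
  defines "w \<equiv> irl1_weight lam q eps x"
  shows "F_eps f lam p q eps x = f x + lam * (\<Sum>i\<in>UNIV. p * (\<bar>x $ i\<bar> * w i - w i powr q / q))"
proof -
  have "0 < ueps lam q CARD('n) eps" using assms by (simp add: ueps_def)
  thus ?thesis
    unfolding F_eps_def w_def irl1_weight_eq[OF conjugate_exponent(1)[OF p]]
    using hfun_eq[OF p] conjugate_exponent(3)[OF p] by (simp cong: if_cong)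
qed

lemma F_eps_ge:
  fixes x :: "real ^ 'n"
  assumes p: "0 < p" "p < 1" "1 / p + 1 / q = 1" and "0 < lam" "0 < eps"
  shows "f x \<le> F_eps f lam p q eps x"
proof -
  have "0 < ueps lam q CARD('n) eps" using assms by (simp add: ueps_def)
  thus ?thesis unfolding F_eps_def
    using assms by (simp add: sum_nonneg hfun_nonneg conjugate_exponent(1)[OF p])
qed

text \<open>Each coordinate costs at most an extra \<open>eps / (lam * n)\<close>, with
  \<open>n\<close> the dimension; \<open>ueps\<close> is chosen so that these errors add up to
  \<open>eps\<close>.\<close>

lemma F_eps_le_lp_objective:
  fixes x :: "real ^ 'n"
  assumes p: "0 < p" "p < 1" "1 / p + 1 / q = 1" and "0 < lam" "0 < eps"
  shows "F_eps f lam p q eps x \<le> lp_objective f lam p x + eps"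
proof -
  let ?u = "ueps lam q CARD('n) eps"
  have u: "0 < ?u" using assms by (simp add: ueps_def)
  have uq: "?u powr q = eps / (lam * real CARD('n))"
    using assms conjugate_exponent(1)[OF p] by (simp add: ueps_def powr_powr)
  have "(\<Sum>i\<in>UNIV. hfun p q ?u (x $ i)) \<le> (\<Sum>i\<in>UNIV. \<bar>x $ i\<bar> powr p + ?u powr q)"
    by (intro sum_mono hfun_le_powr_add p u)
  also have "\<dots> = (\<Sum>i\<in>UNIV. \<bar>x $ i\<bar> powr p) + eps / lam"
    by (simp add: sum.distrib uq)
  finally have "lam * (\<Sum>i\<in>UNIV. hfun p q ?u (x $ i)) \<le> lam * ((\<Sum>i\<in>UNIV. \<bar>x $ i\<bar> powr p) + eps / lam)"
    using assms by (intro mult_left_mono) auto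
  thus ?thesis using assms by (simp add: F_eps_def lp_objective_def distrib_left)
qed

section \<open>Backtracking\<close>

text \<open>The model value at \<open>y\<close> is at most that at \<open>x\<close>. Of the
  quadratic term, \<open>Lf\<close> pays for the descent lemma and the remaining \<open>c\<close> is
  the required decrease.\<close>

lemma irl1_sufficient_decrease_if_large:
  fixes x y :: "real ^ 'n"
  assumes p: "0 < p" "p < 1" "1 / p + 1 / q = 1" and "0 < lam" "0 < eps"
    and grad: "\<And>y. GDERIV f y :> g y"
    and lip: "\<And>y z. norm (g y - g z) \<le> Lf * norm (y - z)"
    and arg: "is_arg_min (irl1_model f g lam p q eps x L) (\<lambda>_. True) y"
    and L: "Lf + c \<le> L"
  shows "irl1_sufficient_decrease f lam p q eps c x y"
proof -
  define w where "w = irl1_weight lam q eps x"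
  define C where "C = lam * (\<Sum>i\<in>UNIV. p * (w i powr q / q))"
  have split: "lam * (\<Sum>i\<in>UNIV. p * (\<bar>z $ i\<bar> * w i - w i powr q / q)) =
      lam * p * (\<Sum>i\<in>UNIV. w i * \<bar>z $ i\<bar>) - C" for z :: "real ^ 'n"
    by (simp add: C_def right_diff_distrib sum_subtractf sum_distrib_left mult.assoc mult.left_commute mult.commute)
  have "(Lf + c) / 2 * (norm (y - x))\<^sup>2 \<le> L / 2 * (norm (y - x))\<^sup>2"
    using L by (intro mult_right_mono) auto
  moreover have "f y \<le> f x + g x \<bullet> (y - x) + Lf / 2 * (norm (y - x))\<^sup>2"
    by (rule descent_lemma[OF grad lip])
  moreover have "irl1_model f g lam p q eps x L y \<le> irl1_model f g lam p q eps x L x"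
    using arg by (auto simp: is_arg_min_linorder)
  moreover have "F_eps f lam p q eps y \<le> f y + lam * p * (\<Sum>i\<in>UNIV. w i * \<bar>y $ i\<bar>) - C"
    using F_eps_le[OF p, of lam eps f y x] assms split[of y] by (simp add: w_def)
  moreover have "F_eps f lam p q eps x = f x + lam * p * (\<Sum>i\<in>UNIV. w i * \<bar>x $ i\<bar>) - C"
    using F_eps_eq[OF p, of lam eps f x] assms split[of x] by (simp add: w_def)
  ultimately show ?thesis
    unfolding irl1_sufficient_decrease_def irl1_model_def w_def[symmetric]
    by (simp add: algebra_simps add_divide_distrib)
qed

text \<open>A rejected \<open>L\<close> is below \<open>Lf + c\<close>, so the next trial
  \<open>\<tau> * L\<close> still respects \<open>B\<close>; the bound is an invariant of the
  loop.\<close>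

lemma irl1_step_accepted:
  fixes x y :: "real ^ 'n"
  assumes "irl1_step f g lam p q eps \<tau> c x L y"
    and p: "0 < p" "p < 1" "1 / p + 1 / q = 1" and pos: "0 < lam" "0 < eps"
    and grad: "\<And>y. GDERIV f y :> g y"
    and lip: "\<And>y z. norm (g y - g z) \<le> Lf * norm (y - z)"
    and \<tau>: "1 < \<tau>" and L: "0 < L" "L \<le> B" and B: "\<tau> * (Lf + c) \<le> B"
  shows "\<exists>L'. 0 < L' \<and> L' \<le> B \<and> is_arg_min (irl1_model f g lam p q eps x L') (\<lambda>_. True) y \<and>
    irl1_sufficient_decrease f lam p q eps c x y"
  using assms(1) L
proof induction
  case (accept L y)
  thus ?case by blast
next
  case (backtrack L y z)
  have "L < Lf + c"
    using irl1_sufficient_decrease_if_large[OF p pos grad lip backtrack.hyps(1)] backtrack.hyps(2)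
    by force
  hence "\<tau> * L \<le> B" using \<tau> B by (smt (verit) mult_strict_left_mono)
  moreover have "0 < \<tau> * L" using \<tau> backtrack.prems by simp
  ultimately show ?case using backtrack.IH by blast
qed

section \<open>Optimality condition of the model\<close>

lemma linear_coeff_eq_0:
  fixes A B :: real
  assumes "\<And>t. \<bar>t\<bar> < 1 \<Longrightarrow> 0 \<le> t * A + t\<^sup>2 * B"
  shows "A = 0"
proof (rule DERIV_local_min)
  show "((\<lambda>t. t * A + t\<^sup>2 * B) has_real_derivative A) (at 0)"
    by (auto intro!: derivative_eq_intros)
  show "\<forall>t. \<bar>0 - t\<bar> < 1 \<longrightarrow> 0 * A + 0\<^sup>2 * B \<le> t * A + t\<^sup>2 * B" using assms by simp
qed simp

text \<open>Scaling the \<open>i\<close>-th coordinate of the minimiser keeps the model smooth even at 0.\<close>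

lemma irl1_model_arg_min_coordinate:
  fixes x y :: "real ^ 'n"
  assumes "is_arg_min (irl1_model f g lam p q eps x L) (\<lambda>_. True) y"
  shows "y $ i * (g x $ i + L * (y $ i - x $ i)) + lam * p * irl1_weight lam q eps x i * \<bar>y $ i\<bar> = 0"
    (is "?A = 0")
proof (rule linear_coeff_eq_0)
  fix t :: real assume t: "\<bar>t\<bar> < 1"
  define w where "w = irl1_weight lam q eps x"
  define z where "z = y + axis i (t * y $ i)"
  have "irl1_model f g lam p q eps x L y \<le> irl1_model f g lam p q eps x L z"
    using assms by (auto simp: is_arg_min_linorder)
  moreover have "g x \<bullet> (z - x) = g x \<bullet> (y - x) + t * y $ i * g x $ i"
    by (simp add: z_def inner_add_right inner_diff_right inner_axis algebra_simps)
  moreover have "(norm (z - x))\<^sup>2 = (norm (y - x))\<^sup>2 + 2 * (t * y $ i * (y $ i - x $ i)) + (t * y $ i)\<^sup>2"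
  proof -
    have "(norm (v + axis i b))\<^sup>2 = (norm v)\<^sup>2 + 2 * (b * v $ i) + b\<^sup>2" for v :: "real ^ 'n" and b
      unfolding power2_norm_eq_inner
      by (simp add: inner_add_left inner_add_right inner_axis inner_axis' power2_eq_square
          distrib_right)
    from this[of "y - x" "t * y $ i"] show ?thesis by (simp add: z_def algebra_simps)
  qed
  moreover have "(\<Sum>j\<in>UNIV. w j * \<bar>z $ j\<bar>) = (\<Sum>j\<in>UNIV. w j * \<bar>y $ j\<bar>) + w i * t * \<bar>y $ i\<bar>"
  proof -
    \<comment> \<open>As \<open>\<bar>t\<bar> < 1\<close>, the factor \<open>1 + t\<close> is
      positive and the absolute value is affine in \<open>t\<close>.\<close>
    have "\<bar>y $ i + t * y $ i\<bar> = \<bar>1 + t\<bar> * \<bar>y $ i\<bar>" by (simp add: abs_mult[symmetric] algebra_simps)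
    hence "w j * \<bar>z $ j\<bar> = w j * \<bar>y $ j\<bar> + (if j = i then w i * t * \<bar>y $ i\<bar> else 0)" for j
      using t by (auto simp: z_def axis_def algebra_simps)
    thus ?thesis by (simp add: sum.distrib)
  qed
  ultimately have "0 \<le> t * y $ i * g x $ i
      + L / 2 * (2 * (t * y $ i * (y $ i - x $ i)) + (t * y $ i)\<^sup>2) + lam * p * (w i * t * \<bar>y $ i\<bar>)"
    unfolding irl1_model_def w_def[symmetric] by (simp only: distrib_left)
  thus "0 \<le> t * ?A + t\<^sup>2 * (L / 2 * (y $ i)\<^sup>2)"
    unfolding w_def[symmetric] by (simp add: algebra_simps power2_eq_square)
qed

section \<open>Convergence along a subsequence\<close>

text \<open>The values of \<open>F\<close> decrease and are bounded below, hence converge; their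
  successive drops tend to 0 and dominate the squared steps.\<close>

lemma diff_tendsto_0_if_sufficient_decrease:
  fixes x :: "nat \<Rightarrow> 'a::real_normed_vector" and F :: "'a \<Rightarrow> real"
  assumes dec: "\<And>k. c / 2 * (norm (x (Suc k) - x k))\<^sup>2 \<le> F (x k) - F (x (Suc k))"
    and c: "0 < c" and bdd: "\<And>k. b \<le> F (x k)"
  shows "(\<lambda>k. x (Suc k) - x k) \<longlonglongrightarrow> 0"
proof -
  have "0 \<le> c / 2 * (norm (x (Suc k) - x k))\<^sup>2" for k using c by simp
  hence "decseq (\<lambda>k. F (x k))"
    using dec by (intro decseq_SucI) (smt (verit))
  then obtain l where l: "(\<lambda>k. F (x k)) \<longlonglongrightarrow> l"
    using decseq_convergent[of "\<lambda>k. F (x k)" b] bdd by metis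
  have "(\<lambda>k. F (x k) - F (x (Suc k))) \<longlonglongrightarrow> 0"
    using tendsto_diff[OF l LIMSEQ_Suc[OF l]] by simp
  hence "(\<lambda>k. c / 2 * (norm (x (Suc k) - x k))\<^sup>2) \<longlonglongrightarrow> 0"
    by (rule tendsto_sandwich[OF always_eventually always_eventually tendsto_const, rotated 2])
      (use c dec in auto)
  from tendsto_mult_left[OF this, of "2 / c"]
  have "(\<lambda>k. (norm (x (Suc k) - x k))\<^sup>2) \<longlonglongrightarrow> 0" using c by simp
  from tendsto_real_sqrt[OF this] show ?thesis by (simp add: tendsto_norm_zero_iff)
qed

theorem theorem4p3:
  fixes f :: "real ^ 'n \<Rightarrow> real"
    and g :: "real ^ 'n \<Rightarrow> real ^ 'n"
    and x :: "nat \<Rightarrow> real ^ 'n"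
    and x0 xstar :: "real ^ 'n"
    and lam p q eps Lf Lmin Lmax \<tau> c :: real
  assumes "0 < lam" and "0 < p" and "p < 1" and "1 / p + 1 / q = 1"
    and "\<And>y. GDERIV f y :> g y"
    and "continuous_on UNIV g"
    and "bdd_below (range f)"
    and "0 < Lf" and "\<And>y z. norm (g y - g z) \<le> Lf * norm (y - z)"
    and "0 < Lmin" and "Lmin < Lmax" and "1 < \<tau>" and "0 < c"
    and "0 < eps"
    and "eps < real CARD('n) * lam *
           (sqrt (2 * Lf * (lp_objective f lam p x0 + eps - (INF y. f y))) / (lam * p)) powr q"
    and "irl1_sequence f g lam p q eps Lmin Lmax \<tau> c x0 x"
    and "accumulation_point x xstar"
  shows "first_order_stationary g lam p xstar \<and>
    (\<forall>i. xstar $ i \<noteq> 0 \<longrightarrow>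
       \<bar>xstar $ i\<bar> \<ge>
         (lam * p / sqrt (2 * Lf * (lp_objective f lam p x0 + eps - (INF y. f y))))
           powr (1 / (1 - p)))"
proof -
  note lam = assms(1) and p = assms(2-4) and grad = assms(5) and gcont = assms(6)
    and bdd = assms(7) and Lf = assms(8) and lip = assms(9) and c = assms(13) and eps = assms(14)
  note q = conjugate_exponent[OF p]
  define u where "u = ueps lam q CARD('n) eps"
  define finf where "finf = (INF y. f y)"
  define D where "D = sqrt (2 * Lf * (lp_objective f lam p x0 + eps - finf))"
  define F where "F = F_eps f lam p q eps"
  \<comment> \<open>The first entry covers the initial trial constant, the second every constant
    reached after a rejection.\<close>
  define B where "B = max Lmax (\<tau> * (Lf + c))"
  have u: "0 < u" using lam eps by (simp add: u_def ueps_def)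
  have finf: "finf \<le> f y" for y using bdd by (simp add: finf_def cINF_lower)
  have "finf \<le> lp_objective f lam p x0"
    using finf[of x0] lam by (simp add: lp_objective_def add_increasing2 sum_nonneg)
  hence D: "0 < D" using Lf eps by (simp add: D_def)
  have "eps / (lam * real CARD('n)) < (D / (lam * p)) powr q"
    using assms(15) lam unfolding D_def finf_def by (simp add: field_simps)
  \<comment> \<open>The negative power \<open>1 / q\<close> reverses the bound on
    \<open>eps\<close>.\<close>
  hence "((D / (lam * p)) powr q) powr (1 / q) < u"
    unfolding u_def ueps_def using lam eps q(1) by (intro powr_less_mono2_neg) auto
  hence "D / (lam * p) < u" using D lam p(1) q(1) by (simp add: powr_powr)
  hence Du: "D < lam * p * u" using lam p(1) by (simp add: pos_divide_less_eq mult.commute)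

  obtain L0 where "L0 k \<in> {Lmin..Lmax}"
    "irl1_step f g lam p q eps \<tau> c (x k) (L0 k) (x (Suc k))" for k
    using assms(16) unfolding irl1_sequence_def by metis
  moreover from this(1) have "0 < L0 k" "L0 k \<le> B" for k
    using assms(10) by (auto simp: B_def le_max_iff_disj intro: less_le_trans)
  moreover have "\<tau> * (Lf + c) \<le> B" by (simp add: B_def)
  ultimately have "\<exists>L'. 0 < L' \<and> L' \<le> B \<and>
      is_arg_min (irl1_model f g lam p q eps (x k) L') (\<lambda>_. True) (x (Suc k)) \<and>
      irl1_sufficient_decrease f lam p q eps c (x k) (x (Suc k))" for k
    using irl1_step_accepted[OF _ p lam eps grad lip assms(12)] by blast
  then obtain L where L: "0 < L k" "L k \<le> B"
      and arg: "is_arg_min (irl1_model f g lam p q eps (x k) (L k)) (\<lambda>_. True) (x (Suc k))"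
      and dec: "c / 2 * (norm (x (Suc k) - x k))\<^sup>2 \<le> F (x k) - F (x (Suc k))" for k
    unfolding irl1_sufficient_decrease_def F_def by metis
  have Ff: "f y \<le> F y" for y unfolding F_def by (rule F_eps_ge[OF p lam eps])
  have "F (x (Suc k)) \<le> F (x k)" for k
    using dec[of k] c by (smt (verit) zero_le_power2 mult_nonneg_nonneg half_gt_zero)
  hence "F (x k) \<le> F (x 0)" for k using lift_Suc_antimono_le[of "\<lambda>k. F (x k)" 0 k] by simp
  moreover have "F (x 0) \<le> lp_objective f lam p x0 + eps"
    using assms(16) F_eps_le_lp_objective[OF p lam eps] by (simp add: irl1_sequence_def F_def)
  ultimately have fx: "f (x k) \<le> lp_objective f lam p x0 + eps" for k
    using Ff[of "x k"] by (meson order_trans)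
  have gD: "norm (g (x k)) \<le> D" for k
  proof -
    have "norm (g (x k)) \<le> sqrt (2 * Lf * (f (x k) - finf))"
      unfolding finf_def by (rule norm_gradient_le[OF grad lip Lf bdd])
    also have "\<dots> \<le> D" unfolding D_def
      using fx[of k] Lf by (intro real_sqrt_le_mono mult_left_mono) auto
    finally show ?thesis .
  qed
  have diff: "(\<lambda>k. x (Suc k) - x k) \<longlonglongrightarrow> 0"
    using dec c order_trans[OF finf Ff] by (rule diff_tendsto_0_if_sufficient_decrease)

  obtain r where r: "strict_mono r" "(\<lambda>j. x (r j)) \<longlonglongrightarrow> xstar"
    using assms(17) by (auto simp: accumulation_point_def o_def)
  have diffr: "(\<lambda>j. x (Suc (r j)) - x (r j)) \<longlonglongrightarrow> 0"
    using LIMSEQ_subseq_LIMSEQ[OF diff r(1)] by (simp add: o_def)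
  have xSuc: "(\<lambda>j. x (Suc (r j))) \<longlonglongrightarrow> xstar"
    using tendsto_add[OF diffr r(2)] by simp
  have gr: "(\<lambda>j. g (x (r j))) \<longlonglongrightarrow> g xstar"
    using gcont r(2) by (auto intro: continuous_on_tendsto_compose)
  \<comment> \<open>The accepted constants may fail to converge; their bound \<open>B\<close>
    suffices, since the steps vanish.\<close>
  have Ldiff: "(\<lambda>j. L (r j) * (x (Suc (r j)) $ i - x (r j) $ i)) \<longlonglongrightarrow> 0" for i
  proof (rule tendsto_rabs_zero_cancel, rule tendsto_sandwich[OF _ _ tendsto_const])
    show "(\<lambda>j. B * \<bar>(x (Suc (r j)) - x (r j)) $ i\<bar>) \<longlonglongrightarrow> 0"
      using tendsto_mult_left[OF tendsto_rabs[OF tendsto_vec_nth[OF diffr, of i]], of B] by simp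
  qed (use L in \<open>auto simp: abs_mult less_imp_le intro!: always_eventually mult_right_mono\<close>)
  have gstar: "norm (g xstar) \<le> D"
    using gD by (intro LIMSEQ_le_const2[OF tendsto_norm[OF gr]]) auto

  have key: "xstar $ i * g xstar $ i + lam * p * \<bar>xstar $ i\<bar> powr p = 0 \<and>
      (lam * p / D) powr (1 / (1 - p)) \<le> \<bar>xstar $ i\<bar>" if nz: "xstar $ i \<noteq> 0" for i
  proof -
    let ?a = "\<bar>xstar $ i\<bar>"
    have xi: "(\<lambda>j. x (r j) $ i) \<longlonglongrightarrow> xstar $ i" by (rule tendsto_vec_nth[OF r(2)])
    have "(\<lambda>j. min u (\<bar>x (r j) $ i\<bar> powr (p - 1))) \<longlonglongrightarrow> min u (?a powr (p - 1))"
      using nz by (intro tendsto_intros xi) auto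
    \<comment> \<open>Eventually the zero branch of the weight formula is avoided, so the weights
      agree with the convergent minimum.\<close>
    moreover have "\<forall>\<^sub>F j in sequentially. x (r j) $ i \<noteq> 0"
      using tendsto_imp_eventually_ne[OF xi nz] .
    hence "\<forall>\<^sub>F j in sequentially.
        min u (\<bar>x (r j) $ i\<bar> powr (p - 1)) = irl1_weight lam q eps (x (r j)) i"
      by eventually_elim (simp add: irl1_weight_eq[OF q(1)] q(3) u_def)
    ultimately have w: "(\<lambda>j. irl1_weight lam q eps (x (r j)) i) \<longlonglongrightarrow> min u (?a powr (p - 1))"
      by (rule Lim_transform_eventually)
    \<comment> \<open>\<open>?G\<close> is the left-hand side of the optimality condition at iterate
      \<open>r j\<close>, hence identically 0, and so is its limit.\<close>
    let ?G = "\<lambda>j. x (Suc (r j)) $ i * (g (x (r j)) $ i + L (r j) * (x (Suc (r j)) $ i - x (r j) $ i))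
        + lam * p * irl1_weight lam q eps (x (r j)) i * \<bar>x (Suc (r j)) $ i\<bar>"
    have "?G \<longlonglongrightarrow> xstar $ i * (g xstar $ i + 0) + lam * p * min u (?a powr (p - 1)) * ?a"
      by (intro tendsto_intros w Ldiff tendsto_vec_nth[OF xSuc] tendsto_vec_nth[OF gr])
    hence "(\<lambda>j. 0) \<longlonglongrightarrow> xstar $ i * g xstar $ i + lam * p * min u (?a powr (p - 1)) * ?a"
      by (simp only: irl1_model_arg_min_coordinate[OF arg] add_0_right)
    hence eq: "xstar $ i * g xstar $ i + lam * p * min u (?a powr (p - 1)) * ?a = 0"
      using LIMSEQ_unique tendsto_const by blast
    hence "xstar $ i * g xstar $ i = - (lam * p * min u (?a powr (p - 1)) * ?a)" by linarith
    \<comment> \<open>Cancelling \<open>?a > 0\<close> makes \<open>lam * p\<close> times the limit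
      weight equal to a gradient entry in absolute value, so at most \<open>D\<close>;
      \<open>Du\<close> then excludes the weight \<open>u\<close>.\<close>
    hence "?a * \<bar>g xstar $ i\<bar> = \<bar>lam * p * min u (?a powr (p - 1)) * ?a\<bar>"
      by (metis abs_mult abs_minus_cancel)
    also have "\<dots> = ?a * (lam * p * min u (?a powr (p - 1)))"
      using lam p u by (simp add: abs_mult)
    finally have "lam * p * min u (?a powr (p - 1)) \<le> D"
      using nz component_le_norm_cart[of "g xstar" i] gstar by simp
    hence mn: "min u (?a powr (p - 1)) = ?a powr (p - 1)" "lam * p * ?a powr (p - 1) \<le> D"
      using Du by (auto simp: min_def split: if_splits)
    have "?a powr (p - 1) * ?a = ?a powr p"
      using nz by (simp add: powr_mult_base mult.commute)
    hence "xstar $ i * g xstar $ i + lam * p * ?a powr p = 0"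
      using eq by (simp add: mn mult.assoc)
    moreover have "(lam * p / D) powr (1 / (1 - p)) \<le> (?a powr (1 - p)) powr (1 / (1 - p))"
    proof (rule powr_mono2)
      \<comment> \<open>Multiplying the second part of \<open>mn\<close> by
        \<open>?a powr (1 - p)\<close> turns the upper bound on the weight into a lower bound on
        \<open>?a\<close>.\<close>
      have "?a powr (p - 1) * ?a powr (1 - p) = 1"
        using nz by (simp add: powr_add[symmetric])
      hence "lam * p = (lam * p * ?a powr (p - 1)) * ?a powr (1 - p)" by simp
      also have "\<dots> \<le> D * ?a powr (1 - p)" by (intro mult_right_mono mn) simp
      finally show "lam * p / D \<le> ?a powr (1 - p)" using D by (simp add: field_simps)
    qed (use p lam D in auto)
    hence "(lam * p / D) powr (1 / (1 - p)) \<le> ?a"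
      using p nz by (simp add: powr_powr)
    ultimately show ?thesis by blast
  qed
  \<comment> \<open>At a zero coordinate both terms vanish, because
    \<open>0 powr p = 0\<close>.\<close>
  hence "xstar $ i * g xstar $ i + lam * p * \<bar>xstar $ i\<bar> powr p = 0" for i
    by (cases "xstar $ i = 0") auto
  thus ?thesis using key unfolding first_order_stationary_def D_def finf_def by blast
qed

end
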